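(* Let $\mathcal{H}$ be a finite-dimensional complex Hilbert space, and let $\mathbf{X} = (X_1, \dots, X_m)$ and $\mathbf{Y} = (Y_1, \dots, Y_n)$ be two arbitrary measurements on $\mathcal{H}$. Then for any pure state (unit vector) $\psi \in \mathcal{H}$, $$H(\mathbf{X},\psi) + H(\mathbf{Y},\psi) \;\geq\; -2\log_2 \max_{i,j} \frac{|\langle \psi, X_i Y_j \psi\rangle|}{\|X_i^{1/2}\psi\|\,\|Y_j^{1/2}\psi\|},$$ where the maximum is over all $1\le i\le m$, $1\le j\le n$ for which $X_i^{1/2}\psi \neq 0$ and $Y_j^{1/2}\psi \neq 0$.
   Context: A measurement on a finite-dimensional complex Hilbert space $\mathcal{H}$ is a finite sequence $\mathbf{X} = (X_1,\dots,X_m)$ of positive (i.e. positive semidefinite) operators on $\mathcal{H}$ with $\sum_{i=1}^m X_i = I$. $X^{1/2}$ denotes the positive semidefinite square root of $X$. A pure state is a unit vector $\psi \in \mathcal{H}$. The entropy of $\mathbf{X}$ in the state $\psi$ is $H(\mathbf{X},\psi) = -\sum_{i=1}^m p_i \log_2 p_i$ with $p_i = \langle \psi, X_i\psi\rangle$ and the convention $0\log_2 0 = 0$. *)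

theory Defs
  imports "HOL-Analysis.Analysis"
begin

text \<open>
  Finite-dimensional complex Hilbert spaces: complex vector spaces spanned by a finite set, with a
  complex inner product; completeness is then automatic. The norm is the one of the underlying real
  inner product space, whose inner product is the real part of \<open>cinner\<close>; hence \<open>cinner\<close> is positive
  definite and \<open>norm x = sqrt (Re (cinner x x))\<close>. As in the physics convention, \<open>cinner\<close> is linear
  in its second argument and conjugate-linear in its first.
\<close>

class fd_complex_hilbert = real_inner +
  fixes scaleC :: "complex \<Rightarrow> 'a \<Rightarrow> 'a"
    and cinner :: "'a \<Rightarrow> 'a \<Rightarrow> complex"
  assumes scaleC_add_right: "scaleC c (x + y) = scaleC c x + scaleC c y"
    and scaleC_add_left: "scaleC (c + d) x = scaleC c x + scaleC d x"
    and scaleC_scaleC: "scaleC c (scaleC d x) = scaleC (c * d) x"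
    and scaleC_of_real: "scaleC (complex_of_real r) x = scaleR r x"
    and cinner_add_right: "cinner x (y + z) = cinner x y + cinner x z"
    and cinner_scaleC_right: "cinner x (scaleC c y) = c * cinner x y"
    and cinner_commute: "cinner y x = cnj (cinner x y)"
    and Re_cinner: "Re (cinner x y) = inner x y"
    and finite_spanning: "\<exists>B. finite B \<and> (\<forall>x. \<exists>c. x = (\<Sum>b\<in>B. scaleC (c b) b))"

lemma vector_space_scaleC: "vector_space (scaleC :: complex \<Rightarrow> 'a \<Rightarrow> 'a::fd_complex_hilbert)"
proof
  show "scaleC 1 x = x" for x :: 'a
    using scaleC_of_real[of 1 x] by simp
qed (simp_all add: scaleC_add_right scaleC_add_left scaleC_scaleC)

lemma finite_dimensional_scaleC:
  "\<exists>B. finite_dimensional_vector_space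
         (scaleC :: complex \<Rightarrow> 'a \<Rightarrow> 'a::fd_complex_hilbert) B"
proof -
  interpret vector_space "scaleC :: complex \<Rightarrow> 'a \<Rightarrow> 'a"
    by (rule vector_space_scaleC)
  obtain S :: "'a set"
    where S: "finite S" "\<And>x. \<exists>c. x = (\<Sum>b\<in>S. scaleC (c b) b)"
    using finite_spanning by metis
  have "x \<in> span S" for x
  proof -
    obtain c where "x = (\<Sum>b\<in>S. scaleC (c b) b)"
      using S(2) by blast
    then show ?thesis
      by (simp add: span_sum span_scale span_base)
  qed
  then have "span S = UNIV"
    by blast
  moreover obtain B where "B \<subseteq> S" "independent B" "S \<subseteq> span B"
    using maximal_independent_subset[of S] by blast
  ultimately have "finite B" "independent B" "span B = UNIV"
    using S(1) finite_subset[of B S] span_mono[of S "span B"] by (auto simp: span_span)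
  then have "finite_dimensional_vector_space (scaleC :: complex \<Rightarrow> 'a \<Rightarrow> 'a) B"
    by unfold_locales
  then show ?thesis ..
qed

lemma cinner_self:
  fixes x :: "'a::fd_complex_hilbert"
  shows "cinner x x = complex_of_real ((norm x)\<^sup>2)"
proof (rule complex_eqI)
  show "Re (cinner x x) = Re (complex_of_real ((norm x)\<^sup>2))"
    by (simp add: Re_cinner dot_square_norm)
  have "Im (cinner x x) = - Im (cinner x x)"
    using arg_cong[OF cinner_commute[of x x], of Im] by simp
  then show "Im (cinner x x) = Im (complex_of_real ((norm x)\<^sup>2))"
    by simp
qed

text \<open>The class contains \<open>\<complex>\<close> and all \<open>\<complex>\<^sup>n\<close> with their standard inner products.\<close>

instantiation complex :: fd_complex_hilbert
begin

definition scaleC_complex :: "complex \<Rightarrow> complex \<Rightarrow> complex" where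
  "scaleC_complex c x = c * x"

definition cinner_complex :: "complex \<Rightarrow> complex \<Rightarrow> complex" where
  "cinner_complex x y = cnj x * y"

instance
proof
  show "\<exists>B. finite B \<and> (\<forall>x::complex. \<exists>c. x = (\<Sum>b\<in>B. scaleC (c b) b))"
    by (rule exI[of _ "{1}"]) (auto simp: scaleC_complex_def)
qed (auto simp: scaleC_complex_def cinner_complex_def inner_complex_def algebra_simps
       scaleR_conv_of_real)

end

instantiation vec :: (fd_complex_hilbert, finite) fd_complex_hilbert
begin

definition scaleC_vec :: "complex \<Rightarrow> 'a ^ 'b \<Rightarrow> 'a ^ 'b" where
  "scaleC_vec c x = (\<chi> i. scaleC c (x $ i))"

definition cinner_vec :: "'a ^ 'b \<Rightarrow> 'a ^ 'b \<Rightarrow> complex" where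
  "cinner_vec x y = (\<Sum>i\<in>UNIV. cinner (x $ i) (y $ i))"

instance
proof
  fix x y z :: "'a ^ 'b" and c d :: complex and r :: real
  show "scaleC c (x + y) = scaleC c x + scaleC c y"
    by (simp add: scaleC_vec_def vec_eq_iff scaleC_add_right)
  show "scaleC (c + d) x = scaleC c x + scaleC d x"
    by (simp add: scaleC_vec_def vec_eq_iff scaleC_add_left)
  show "scaleC c (scaleC d x) = scaleC (c * d) x"
    by (simp add: scaleC_vec_def vec_eq_iff scaleC_scaleC)
  show "scaleC (complex_of_real r) x = scaleR r x"
    by (simp add: scaleC_vec_def vec_eq_iff scaleC_of_real)
  show "cinner x (y + z) = cinner x y + cinner x z"
    by (simp add: cinner_vec_def cinner_add_right sum.distrib)
  show "cinner x (scaleC c y) = c * cinner x y"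
    by (simp add: cinner_vec_def scaleC_vec_def cinner_scaleC_right sum_distrib_left)
  show "cinner y x = cnj (cinner x y)"
    unfolding cinner_vec_def cnj_sum by (rule sum.cong[OF refl cinner_commute])
  show "Re (cinner x y) = inner x y"
    by (simp add: cinner_vec_def inner_vec_def Re_cinner)
next
  obtain S :: "'a set"
    where S: "finite S" "\<And>x. \<exists>c. x = (\<Sum>b\<in>S. scaleC (c b) b)"
    using finite_spanning by metis
  interpret vector_space "scaleC :: complex \<Rightarrow> 'a \<Rightarrow> 'a"
    by (rule vector_space_scaleC)
  define T where "T = S - {0}"
  have T: "finite T" "\<exists>c. x = (\<Sum>b\<in>T. scaleC (c b) b)" for x
  proof -
    show "finite T"
      using S(1) by (simp add: T_def)
    obtain c where "x = (\<Sum>b\<in>S. scaleC (c b) b)"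
      using S(2) by blast
    also have "\<dots> = (\<Sum>b\<in>T. scaleC (c b) b)"
      using S(1) by (intro sum.mono_neutral_right) (auto simp: T_def scale_zero_right)
    finally show "\<exists>c. x = (\<Sum>b\<in>T. scaleC (c b) b)"
      by (rule exI[of _ c])
  qed
  then obtain C where C: "\<And>x. x = (\<Sum>b\<in>T. scaleC (C x b) b)"
    by metis
  define ax :: "'b \<times> 'a \<Rightarrow> 'a ^ 'b" where "ax = (\<lambda>(i, b). axis i b)"
  have inj: "inj_on ax (UNIV \<times> T)"
    by (auto simp: inj_on_def ax_def T_def axis_eq_axis)
  have "\<exists>c. x = (\<Sum>v\<in>ax ` (UNIV \<times> T). scaleC (c v) v)" for x :: "'a ^ 'b"
  proof
    define g where "g v = (case inv_into (UNIV \<times> T) ax v of (i, b) \<Rightarrow> C (x $ i) b)" for v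
    have "(\<Sum>v\<in>ax ` (UNIV \<times> T). scaleC (g v) v) = (\<Sum>p\<in>UNIV \<times> T. scaleC (g (ax p)) (ax p))"
      by (rule sum.reindex[OF inj, unfolded o_def])
    also have "\<dots> = (\<Sum>p\<in>UNIV \<times> T. case p of (i, b) \<Rightarrow> scaleC (C (x $ i) b) (axis i b))"
      by (rule sum.cong) (auto simp: g_def inv_into_f_f[OF inj], simp add: ax_def)
    also have "\<dots> = (\<Sum>i\<in>UNIV. \<Sum>b\<in>T. scaleC (C (x $ i) b) (axis i b))"
      by (simp add: sum.cartesian_product)
    also have "\<dots> = x"
    proof (subst vec_eq_iff, intro allI)
      fix k
      have "(\<Sum>b\<in>T. scaleC (C (x $ i) b) (axis i b)) $ k =
          (if i = k then \<Sum>b\<in>T. scaleC (C (x $ i) b) b else 0)" for i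
        by (simp add: scaleC_vec_def axis_def scale_zero_right)
      then show "(\<Sum>i\<in>UNIV. \<Sum>b\<in>T. scaleC (C (x $ i) b) (axis i b)) $ k = x $ k"
        using C[of "x $ k"] by (simp add: sum_component)
    qed
    finally show "x = (\<Sum>v\<in>ax ` (UNIV \<times> T). scaleC (g v) v)" ..
  qed
  then show "\<exists>B. finite B \<and> (\<forall>x :: 'a ^ 'b. \<exists>c. x = (\<Sum>v\<in>B. scaleC (c v) v))"
    using T(1) by (intro exI[of _ "ax ` (UNIV \<times> T)"]) simp
qed

end

definition positive_operator :: "('a::fd_complex_hilbert \<Rightarrow> 'a) \<Rightarrow> bool" where
  "positive_operator A \<longleftrightarrow>
     Vector_Spaces.linear scaleC scaleC A \<and> (\<forall>x. cinner x (A x) \<in> \<real>\<^sub>\<ge>\<^sub>0)"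

text \<open>
  The description is meaningful only for positive \<open>A\<close>, which have exactly one positive square root.
\<close>

definition sqrt_operator :: "('a::fd_complex_hilbert \<Rightarrow> 'a) \<Rightarrow> 'a \<Rightarrow> 'a" where
  "sqrt_operator A = (THE S. positive_operator S \<and> S \<circ> S = A)"

definition measurement :: "nat \<Rightarrow> (nat \<Rightarrow> 'a::fd_complex_hilbert \<Rightarrow> 'a) \<Rightarrow> bool" where
  "measurement m X \<longleftrightarrow>
     (\<forall>i\<in>{1..m}. positive_operator (X i)) \<and> (\<forall>x. (\<Sum>i=1..m. X i x) = x)"

definition outcome_prob :: "('a::fd_complex_hilbert \<Rightarrow> 'a) \<Rightarrow> 'a \<Rightarrow> real" where
  "outcome_prob A \<psi> = Re (cinner \<psi> (A \<psi>))"

text \<open>The convention \<open>0 log 0 = 0\<close> holds because of the factor \<open>p\<^sub>i = 0\<close>.\<close>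

definition measurement_entropy ::
    "nat \<Rightarrow> (nat \<Rightarrow> 'a::fd_complex_hilbert \<Rightarrow> 'a) \<Rightarrow> 'a \<Rightarrow> real" where
  "measurement_entropy m X \<psi> =
     - (\<Sum>i=1..m. outcome_prob (X i) \<psi> * log 2 (outcome_prob (X i) \<psi>))"

end

theory Submission
  imports Defs "HOL-Complex_Analysis.Complex_Analysis" "HOL-Real_Asymp.Real_Asymp"
    "HOL-Computational_Algebra.Fundamental_Theorem_Algebra"
begin

text \<open>
  Consider the entire function \<open>F(z) = \<Sum>\<^sub>i\<^sub>j \<langle>\<psi>, X\<^sub>i Y\<^sub>j \<psi>\<rangle> (p\<^sub>i q\<^sub>j)\<^bsup>z/2\<^esup>\<close>, where \<open>p\<^sub>i\<close> and \<open>q\<^sub>j\<close> are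
  the outcome probabilities, and let \<open>c\<close> be the maximum in the theorem. On \<open>Re z = 0\<close> \<open>F\<close> is bounded
  by 1, because \<open>\<Sum>\<^sub>i u\<^sub>i X\<^sub>i\<close> is a contraction for unimodular \<open>u\<^sub>i\<close>; on \<open>Re z = 1\<close> it is bounded by
  \<open>\<Sum>\<^sub>i\<^sub>j c p\<^sub>i q\<^sub>j = c\<close>. By the three lines theorem \<open>\<bar>F(x)\<bar> \<le> c\<^sup>x\<close> for \<open>0 \<le> x \<le> 1\<close>, with equality at 0,
  so \<open>F'(0) \<le> ln c\<close>. Since \<open>\<Sum>\<^sub>i X\<^sub>i = \<Sum>\<^sub>j Y\<^sub>j = I\<close>, the number \<open>-2 F'(0)\<close> is the sum of the two
  entropies (in nats).

  Positive square roots are obtained algebraically: by the fundamental theorem of algebra every vector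
  is a sum of eigenvectors of a given self-adjoint operator.
\<close>

subsection \<open>Complex inner products and self-adjoint operators\<close>

interpretation scaleC: vector_space "scaleC :: complex \<Rightarrow> 'a \<Rightarrow> 'a::fd_complex_hilbert"
  by (rule vector_space_scaleC)

interpretation scaleC_pair: vector_space_pair
  "scaleC :: complex \<Rightarrow> 'a \<Rightarrow> 'a::fd_complex_hilbert"
  "scaleC :: complex \<Rightarrow> 'b \<Rightarrow> 'b::fd_complex_hilbert" ..

lemmas scaleC_distribs =
  scaleC.scale_left_distrib scaleC.scale_right_distrib
  scaleC.scale_left_diff_distrib scaleC.scale_right_diff_distrib

abbreviation clinear :: "('a::fd_complex_hilbert \<Rightarrow> 'b::fd_complex_hilbert) \<Rightarrow> bool" where
  "clinear \<equiv> Vector_Spaces.linear scaleC scaleC"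

lemma clinear_add: "clinear A \<Longrightarrow> A (x + y) = A x + A y"
  and clinear_diff: "clinear A \<Longrightarrow> A (x - y) = A x - A y"
  and clinear_scaleC: "clinear A \<Longrightarrow> A (scaleC c x) = scaleC c (A x)"
  and clinear_zero: "clinear A \<Longrightarrow> A 0 = 0"
  by (simp_all add: scaleC_pair.linear_add scaleC_pair.linear_diff scaleC_pair.linear_scale
      scaleC_pair.linear_0)

lemma cinner_add_left: "cinner (x + y) z = cinner x z + cinner y (z::'a::fd_complex_hilbert)"
  by (metis cinner_add_right cinner_commute complex_cnj_add)

lemma cinner_scaleC_left: "cinner (scaleC c x) y = cnj c * cinner x (y::'a::fd_complex_hilbert)"
  by (metis cinner_scaleC_right cinner_commute complex_cnj_mult)

lemma cinner_zero_right [simp]: "cinner x (0::'a::fd_complex_hilbert) = 0"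
  by (metis add_cancel_left_left cinner_add_right)

lemma cinner_zero_left [simp]: "cinner 0 (x::'a::fd_complex_hilbert) = 0"
  by (metis add_cancel_left_left cinner_add_left)

lemma cinner_diff_right: "cinner x (y - z) = cinner x y - cinner x (z::'a::fd_complex_hilbert)"
  by (metis cinner_add_right diff_add_cancel add_diff_cancel_right')

lemma cinner_sum_right: "cinner x (\<Sum>i\<in>I. f i) = (\<Sum>i\<in>I. cinner x (f i :: 'a::fd_complex_hilbert))"
  by (induction I rule: infinite_finite_induct) (simp_all add: cinner_add_right)

lemma cinner_sum_left: "cinner (\<Sum>i\<in>I. f i) x = (\<Sum>i\<in>I. cinner (f i) (x :: 'a::fd_complex_hilbert))"
  by (induction I rule: infinite_finite_induct) (simp_all add: cinner_add_left)

lemma cinner_self_eq_0 [simp]: "cinner x x = 0 \<longleftrightarrow> x = (0::'a::fd_complex_hilbert)"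
  by (simp add: cinner_self)

lemma norm_scaleC: "norm (scaleC c x) = cmod c * norm (x::'a::fd_complex_hilbert)"
proof -
  have "complex_of_real ((norm (scaleC c x))\<^sup>2) = cnj c * c * complex_of_real ((norm x)\<^sup>2)"
    unfolding cinner_self[symmetric] by (simp add: cinner_scaleC_left cinner_scaleC_right)
  also have "cnj c * c = complex_of_real ((cmod c)\<^sup>2)"
    unfolding complex_norm_square by (rule mult.commute)
  also have "\<dots> * complex_of_real ((norm x)\<^sup>2) = complex_of_real ((cmod c * norm x)\<^sup>2)"
    by (simp add: power_mult_distrib)
  finally show ?thesis
    by (simp only: of_real_eq_iff) (simp add: power2_eq_iff_nonneg)
qed

lemma cmod_cinner_le: "cmod (cinner x y) \<le> norm x * norm (y::'a::fd_complex_hilbert)"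
proof (cases "cinner x y = 0")
  case False
  \<comment> \<open>Rotating \<open>y\<close> by the phase \<open>u\<close> makes the inner product
    real and nonnegative, so that the real Cauchy-Schwarz inequality applies.\<close>
  define u where "u = cnj (sgn (cinner x y))"
  have "cinner x (scaleC u y) = complex_of_real (cmod (cinner x y))"
    using False by (simp add: u_def cinner_scaleC_right sgn_eq complex_norm_square[symmetric]
        power2_eq_square mult.commute)
  then have "cmod (cinner x y) = inner x (scaleC u y)"
    by (metis Re_cinner Re_complex_of_real)
  also have "\<dots> \<le> norm x * norm (scaleC u y)"
    by (rule norm_cauchy_schwarz)
  also have "norm (scaleC u y) = norm y"
    using False by (simp add: u_def norm_scaleC norm_sgn)
  finally show ?thesis .
qed simp

section \<open>Self-adjoint operators and their eigenvectors\<close>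

definition self_adjoint :: "('a::fd_complex_hilbert \<Rightarrow> 'a) \<Rightarrow> bool" where
  "self_adjoint A \<longleftrightarrow> clinear A \<and> (\<forall>x y. cinner x (A y) = cinner (A x) y)"

lemma self_adjoint_clinear: "self_adjoint A \<Longrightarrow> clinear A"
  and self_adjointD: "self_adjoint A \<Longrightarrow> cinner x (A y) = cinner (A x) y"
  by (auto simp: self_adjoint_def)

text \<open>Polarization: the form \<open>cinner x (A x)\<close> is real, so at \<open>x + z\<close>
  the imaginary parts of the cross terms cancel. Taking \<open>z = y\<close> compares imaginary
  parts, \<open>z = scaleC \<i> y\<close> real parts.\<close>

lemma positive_operator_self_adjoint:
  assumes "positive_operator A"
  shows "self_adjoint A"
proof -
  have lin: "clinear A" and pos: "Im (cinner x (A x)) = 0" for x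
    using assms by (auto simp: positive_operator_def complex_nonneg_Reals_iff)
  have "cinner x (A y) = cinner (A x) y" for x y
  proof -
    have im: "Im (cinner x (A z)) + Im (cinner z (A x)) = 0" for z
      using pos[of "x + z"] pos[of x] pos[of z]
      by (simp add: clinear_add[OF lin] cinner_add_left cinner_add_right)
    have "Im (cinner x (A y)) + Im (cinner y (A x)) = 0"
      by (rule im)
    moreover have "Re (cinner x (A y)) - Re (cinner y (A x)) = 0"
      using im[of "scaleC \<i> y"]
      by (simp add: clinear_scaleC[OF lin] cinner_scaleC_left cinner_scaleC_right)
    ultimately have "cinner x (A y) = cnj (cinner y (A x))"
      by (simp add: complex_eq_iff)
    then show ?thesis
      by (simp flip: cinner_commute)
  qed
  with lin show ?thesis
    by (simp add: self_adjoint_def)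
qed

lemma self_adjoint_eigenvalue_real:
  assumes "self_adjoint A" "A v = scaleC \<mu> v" "v \<noteq> 0"
  shows "cnj \<mu> = \<mu>"
  using self_adjointD[OF assms(1), of v v] assms(2,3)
  by (simp add: cinner_scaleC_left cinner_scaleC_right)

lemma self_adjoint_eigenvectors_orthogonal:
  assumes "self_adjoint A" "A v = scaleC \<mu> v" "A w = scaleC \<nu> w" "\<mu> \<noteq> \<nu>"
  shows "cinner v w = 0"
proof (cases "v = 0")
  case False
  have "\<nu> * cinner v w = \<mu> * cinner v w"
    using self_adjointD[OF assms(1), of v w] assms(2,3)
      self_adjoint_eigenvalue_real[OF assms(1,2) False]
    by (simp add: cinner_scaleC_left cinner_scaleC_right)
  with assms(4) show ?thesis
    by simp
qed simp

subsection \<open>Eigenvectors of self-adjoint operators span\<close>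

text \<open>This is p(A) x in the manner of Horner, with \<open>A\<close> acting on the argument;
  the recursion follows \<open>pCons\<close>, so its laws go by induction on
  \<open>p\<close>.\<close>

definition poly_operator :: "('a::fd_complex_hilbert \<Rightarrow> 'a) \<Rightarrow> complex poly \<Rightarrow> 'a \<Rightarrow> 'a" where
  "poly_operator A p = fold_coeffs (\<lambda>a f x. scaleC a x + f (A x)) p (\<lambda>x. 0)"

lemma poly_operator_0 [simp]: "poly_operator A 0 x = 0"
  by (simp add: poly_operator_def)

lemma poly_operator_pCons [simp]:
  "poly_operator A (pCons a p) x = scaleC a x + poly_operator A p (A x)"
  by (cases "p = 0 \<and> a = 0") (auto simp: poly_operator_def)

lemma poly_operator_add:
  "poly_operator A (p + q) x = poly_operator A p x + poly_operator A q x"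
  by (induction p q arbitrary: x rule: poly_induct2) (simp_all add: scaleC_distribs algebra_simps)

lemma poly_operator_diff:
  "poly_operator A (p - q) x = poly_operator A p x - poly_operator A q x"
  using poly_operator_add[of A "p - q" q x] by (simp add: algebra_simps)

lemma poly_operator_sum:
  "poly_operator A (\<Sum>i\<in>I. p i) x = (\<Sum>i\<in>I. poly_operator A (p i) x)"
  by (induction I rule: infinite_finite_induct) (simp_all add: poly_operator_add)

lemma poly_operator_smult: "poly_operator A (smult c p) x = scaleC c (poly_operator A p x)"
  by (induction p arbitrary: x) (simp_all add: scaleC_distribs algebra_simps)

lemma poly_operator_monom: "poly_operator A (monom c k) x = scaleC c ((A ^^ k) x)"
  by (induction k arbitrary: x) (simp_all add: monom_0 monom_Suc funpow_swap1)

lemma poly_operator_diff_right: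
  assumes "clinear A"
  shows "poly_operator A p (x - y) = poly_operator A p x - poly_operator A p y"
  by (induction p arbitrary: x y) (simp_all add: clinear_diff[OF assms] scaleC_distribs algebra_simps)

lemma poly_operator_scaleC_right:
  assumes "clinear A"
  shows "poly_operator A p (scaleC c x) = scaleC c (poly_operator A p x)"
  by (induction p arbitrary: x) (simp_all add: clinear_scaleC[OF assms] scaleC_distribs algebra_simps)

text \<open>Drives the induction on the degree below: if the product annihilates \<open>x\<close>,
  then the cofactor \<open>p\<close> annihilates \<open>A x - scaleC \<mu> x\<close>.\<close>

lemma poly_operator_linear_factor:
  assumes "clinear A"
  shows "poly_operator A ([:- \<mu>, 1:] * p) x = poly_operator A p (A x - scaleC \<mu> x)"
  by (simp add: poly_operator_diff poly_operator_smult poly_operator_diff_right[OF assms]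
      poly_operator_scaleC_right[OF assms])

text \<open>In finite dimension the iterates of \<open>x\<close> under \<open>A\<close> either
  repeat or are infinitely many and hence linearly dependent; a relation among them is a
  polynomial.\<close>

lemma annihilating_polynomial_exists:
  fixes A :: "'a::fd_complex_hilbert \<Rightarrow> 'a"
  shows "\<exists>p. p \<noteq> 0 \<and> poly_operator A p x = 0"
proof (cases "inj (\<lambda>k. (A ^^ k) x)")
  case False
  then obtain i j where "i \<noteq> j" "(A ^^ i) x = (A ^^ j) x"
    by (auto simp: inj_def)
  then have "poly_operator A (monom 1 i + monom (-1) j) x = 0"
    by (simp only: poly_operator_add poly_operator_monom) simp
  moreover have "coeff (monom 1 i + monom (-1) j :: complex poly) i \<noteq> 0"
    using \<open>i \<noteq> j\<close> by simp
  ultimately show ?thesis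
    by (metis coeff_0)
next
  case True
  obtain S :: "'a set" where S: "finite S" "\<And>x. \<exists>c. x = (\<Sum>b\<in>S. scaleC (c b) b)"
    using finite_spanning by metis
  have "y \<in> scaleC.span S" for y
  proof -
    obtain c where "y = (\<Sum>b\<in>S. scaleC (c b) b)"
      using S(2) by blast
    then show ?thesis
      by (simp add: scaleC.span_sum scaleC.span_scale scaleC.span_base)
  qed
  moreover have "infinite (range (\<lambda>k. (A ^^ k) x))"
    using True by (simp add: finite_image_iff)
  ultimately have "scaleC.dependent (range (\<lambda>k. (A ^^ k) x))"
    using scaleC.independent_span_bound[OF S(1)] by blast
  then obtain T u where T: "finite T" "T \<subseteq> range (\<lambda>k. (A ^^ k) x)"
    "(\<Sum>v\<in>T. scaleC (u v) v) = 0" "\<exists>v\<in>T. u v \<noteq> 0"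
    by (auto simp: scaleC.dependent_explicit)
  then obtain K where K: "finite K" "T = (\<lambda>k. (A ^^ k) x) ` K"
    by (meson finite_subset_image)
  \<comment> \<open>Distinct exponents give distinct iterates here, so each vector of the relation
    belongs to exactly one power of \<open>A\<close>.\<close>
  define p where "p = (\<Sum>k\<in>K. monom (u ((A ^^ k) x)) k)"
  have "poly_operator A p x = (\<Sum>v\<in>T. scaleC (u v) v)"
    using True by (simp add: p_def poly_operator_sum poly_operator_monom K(2) sum.reindex
        inj_on_subset[OF True])
  moreover obtain k where "k \<in> K" "u ((A ^^ k) x) \<noteq> 0"
    using T(4) K(2) by auto
  then have "coeff p k \<noteq> 0"
    using K(1) by (simp add: p_def coeff_sum)
  ultimately show ?thesis
    using T(3) by (metis coeff_0)
qed

text \<open>On an eigenvector with eigenvalue other than \<open>\<kappa>\<close>, A - \<kappa> is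
  inverted by a scalar; eigenvectors for \<open>\<kappa>\<close> itself are collected in the kernel
  vector \<open>w\<close>.\<close>

lemma span_eigenvectors_of_diff:
  assumes "clinear A" "y \<in> scaleC.span {v. \<exists>\<mu>. A v = scaleC \<mu> v}"
  shows "\<exists>z w. z \<in> scaleC.span {v. \<exists>\<mu>. A v = scaleC \<mu> v} \<and> A w = scaleC \<kappa> w
    \<and> y = A z - scaleC \<kappa> z + w"
  using assms(2)
proof (induction rule: scaleC.span_induct_alt)
  case base
  show ?case
    by (rule exI[of _ 0], rule exI[of _ 0])
      (simp add: clinear_zero[OF assms(1)] scaleC.span_zero)
next
  case (step c v y)
  from step.IH obtain z w where zw: "z \<in> scaleC.span {v. \<exists>\<mu>. A v = scaleC \<mu> v}"
    "A w = scaleC \<kappa> w" "y = A z - scaleC \<kappa> z + w"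
    by blast
  from step.hyps obtain \<mu> where \<mu>: "A v = scaleC \<mu> v"
    by blast
  show ?case
  proof (cases "\<mu> = \<kappa>")
    case True
    then have "A (scaleC c v + w) = scaleC \<kappa> (scaleC c v + w)"
      using \<mu> zw(2) by (simp add: clinear_add[OF assms(1)] clinear_scaleC[OF assms(1)]
          scaleC.scale_right_distrib mult.commute)
    moreover have "scaleC c v + y = A z - scaleC \<kappa> z + (scaleC c v + w)"
      using zw(3) by (simp add: algebra_simps)
    ultimately show ?thesis
      using zw(1) by blast
  next
    case False
    \<comment> \<open>Chosen so that A - \<kappa> maps \<open>scaleC d v\<close> to
      \<open>scaleC c v\<close>.\<close>
    define d where "d = c / (\<mu> - \<kappa>)"
    define z' where "z' = scaleC d v + z"
    have "z' \<in> scaleC.span {v. \<exists>\<mu>. A v = scaleC \<mu> v}"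
      unfolding z'_def using \<mu>
      by (intro scaleC.span_add scaleC.span_scale zw(1)) (auto intro: scaleC.span_base)
    moreover have "c = d * \<mu> - \<kappa> * d"
      using False by (simp add: d_def divide_simps) (simp add: algebra_simps)
    then have "scaleC c v + y = A z' - scaleC \<kappa> z' + w"
      by (simp add: zw(3) z'_def \<mu> clinear_add[OF assms(1)] clinear_scaleC[OF assms(1)]
          scaleC_distribs)
    ultimately show ?thesis
      using zw(2) by blast
  qed
qed

text \<open>Splitting off a root \<kappa> of \<open>p\<close> puts (A - \<kappa>) x into the span by
  induction. Solving there up to a kernel vector \<open>w\<close> leaves \<open>y = x - z\<close>
  with (A - \<kappa>) y = w. Self-adjointness forces \<open>w = 0\<close>, so \<open>x\<close> is
  \<open>z\<close> plus a vector of the kernel of A - \<kappa>.\<close>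

lemma span_eigenvectors_if_annihilated:
  assumes "self_adjoint A" "p \<noteq> 0" "poly_operator A p x = 0"
  shows "x \<in> scaleC.span {v. \<exists>\<mu>. A v = scaleC \<mu> v}"
  using assms(2,3)
proof (induction "degree p" arbitrary: p x rule: less_induct)
  case less
  note lin = self_adjoint_clinear[OF assms(1)]
  show ?case
  proof (cases "degree p = 0")
    case True
    then obtain a where "p = [:a:]"
      by (rule degree_eq_zeroE)
    with less.prems show ?thesis
      by (simp add: scaleC.span_zero)
  next
    case False
    then obtain \<kappa> where "poly p \<kappa> = 0"
      using Fundamental_Theorem_Algebra.fundamental_theorem_of_algebra[of p] by (auto simp: constant_degree)
    then obtain q where q: "p = [:- \<kappa>, 1:] * q"
      by (metis dvdE poly_eq_0_iff_dvd)
    with less.prems(1) have "q \<noteq> 0"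
      by auto
    then have "degree p = Suc (degree q)"
      by (simp add: q degree_mult_eq del: mult_pCons_left)
    then have "A x - scaleC \<kappa> x \<in> scaleC.span {v. \<exists>\<mu>. A v = scaleC \<mu> v}"
      using less.hyps[of q] less.prems(2) \<open>q \<noteq> 0\<close>
      by (simp add: q poly_operator_linear_factor[OF lin] del: mult_pCons_left)
    then obtain z w where zw: "z \<in> scaleC.span {v. \<exists>\<mu>. A v = scaleC \<mu> v}"
      "A w = scaleC \<kappa> w" "A x - scaleC \<kappa> x = A z - scaleC \<kappa> z + w"
      using span_eigenvectors_of_diff[OF lin] by blast
    define y where "y = x - z"
    have y: "A y - scaleC \<kappa> y = w"
      using zw(3) by (simp add: y_def clinear_diff[OF lin] scaleC.scale_right_diff_distrib
          algebra_simps)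
    \<comment> \<open>\<open>w\<close> lies both in the kernel and in the range of \<open>A - \<kappa>\<close>, which are orthogonal.\<close>
    have "w = 0"
    proof (rule ccontr)
      assume "w \<noteq> 0"
      have "cinner w w = cinner w (A y) - \<kappa> * cinner w y"
        by (simp add: cinner_diff_right cinner_scaleC_right flip: y)
      also have "\<dots> = 0"
        using self_adjoint_eigenvalue_real[OF assms(1) zw(2) \<open>w \<noteq> 0\<close>]
        by (simp add: self_adjointD[OF assms(1)] zw(2) cinner_scaleC_left)
      finally show False
        using \<open>w \<noteq> 0\<close> by simp
    qed
    with y have "y \<in> scaleC.span {v. \<exists>\<mu>. A v = scaleC \<mu> v}"
      by (auto intro: scaleC.span_base)
    then have "z + y \<in> scaleC.span {v. \<exists>\<mu>. A v = scaleC \<mu> v}"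
      using zw(1) scaleC.span_add by blast
    then show ?thesis
      by (simp add: y_def)
  qed
qed

lemma span_eigenvectors_eq_UNIV:
  assumes "self_adjoint A"
  shows "scaleC.span {v. \<exists>\<mu>. A v = scaleC \<mu> v} = UNIV"
  using annihilating_polynomial_exists[of A] span_eigenvectors_if_annihilated[OF assms] by blast

subsection \<open>Positive square roots\<close>

lemma positive_operator_eigenvalue:
  assumes "positive_operator A" "A v = scaleC \<mu> v" "v \<noteq> 0"
  shows "\<mu> = complex_of_real (Re \<mu>)" "0 \<le> Re \<mu>"
proof -
  show *: "\<mu> = complex_of_real (Re \<mu>)"
    using self_adjoint_eigenvalue_real[OF positive_operator_self_adjoint[OF assms(1)] assms(2,3)]
    by (simp add: complex_eq_iff)
  have "0 \<le> Re (cinner v (A v))"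
    using assms(1) by (auto simp: positive_operator_def complex_nonneg_Reals_iff)
  also have "Re (cinner v (A v)) = Re \<mu> * (norm v)\<^sup>2"
    using arg_cong[OF *, of Im] by (simp add: assms(2) cinner_scaleC_right cinner_self)
  finally show "0 \<le> Re \<mu>"
    using assms(3) by (simp add: zero_le_mult_iff)
qed

lemma clinear_eq_on_span:
  assumes "clinear f" "clinear g" "scaleC.span B = UNIV" "\<And>b. b \<in> B \<Longrightarrow> f b = g b"
  shows "f = g"
  using scaleC_pair.linear_eq_on[OF assms(1,2) _ assms(4)] assms(3) by blast

lemma self_adjoint_if_on_span:
  assumes "clinear A" "scaleC.span B = UNIV"
    and "\<And>b c. b \<in> B \<Longrightarrow> c \<in> B \<Longrightarrow> cinner b (A c) = cinner (A b) c"
  shows "self_adjoint A"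
proof -
  have *: "cinner b (A y) = cinner (A b) y" if "b \<in> B" for b y
  proof -
    have "y \<in> scaleC.span B"
      using assms(2) by simp
    then show ?thesis
      by (induction rule: scaleC.span_induct_alt)
        (simp_all add: clinear_zero[OF assms(1)] clinear_add[OF assms(1)]
          clinear_scaleC[OF assms(1)] cinner_add_right cinner_scaleC_right assms(3) that)
  qed
  have "cinner x (A y) = cinner (A x) y" for x y
  proof -
    have "x \<in> scaleC.span B"
      using assms(2) by simp
    then show ?thesis
      by (induction rule: scaleC.span_induct_alt)
        (simp_all add: clinear_zero[OF assms(1)] clinear_add[OF assms(1)]
          clinear_scaleC[OF assms(1)] cinner_add_left cinner_scaleC_left *)
  qed
  with assms(1) show ?thesis
    by (simp add: self_adjoint_def)
qed

lemma positive_operator_square: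
  assumes "self_adjoint R"
  shows "positive_operator (R \<circ> R)"
proof -
  have "clinear (R \<circ> R)"
    using self_adjoint_clinear[OF assms] by (intro Vector_Spaces.linear_compose)
  then show ?thesis
    by (simp add: positive_operator_def self_adjointD[OF assms] cinner_self complex_nonneg_Reals_iff)
qed

text \<open>The root acts on a basis of eigenvectors of \<open>A\<close> by the square roots of the
  eigenvalues, which are real and nonnegative.\<close>

lemma positive_square_root_exists:
  assumes "positive_operator A"
  shows "\<exists>S. positive_operator S \<and> S \<circ> S = A"
proof -
  note sa = positive_operator_self_adjoint[OF assms]
  obtain B where B: "B \<subseteq> {v. \<exists>\<mu>. A v = scaleC \<mu> v}" "scaleC.independent B"
    "{v. \<exists>\<mu>. A v = scaleC \<mu> v} \<subseteq> scaleC.span B"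
    using scaleC.maximal_independent_subset by blast
  have span: "scaleC.span B = UNIV"
    using scaleC.span_minimal[OF B(3) scaleC.subspace_span] span_eigenvectors_eq_UNIV[OF sa]
    by auto
  have "\<forall>b\<in>B. \<exists>\<mu>. A b = scaleC \<mu> b"
    using B(1) by blast
  then obtain l where l: "\<And>b. b \<in> B \<Longrightarrow> A b = scaleC (l b) b"
    by metis
  have nz: "b \<noteq> 0" if "b \<in> B" for b
    using B(2) that scaleC.dependent_zero by blast
  \<comment> \<open>Self-adjointness, unlike positivity, can be checked on \<open>B\<close>, so the root is built as the square
    of a self-adjoint fourth root.\<close>
  define r where "r b = complex_of_real (sqrt (sqrt (Re (l b))))" for b
  define R where "R = scaleC_pair.construct B (\<lambda>b. scaleC (r b) b)"
  have lin: "clinear R"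
    unfolding R_def by (rule scaleC_pair.linear_construct[OF B(2)])
  have R: "R b = scaleC (r b) b" if "b \<in> B" for b
    using that by (simp add: R_def scaleC_pair.construct_basis[OF B(2)])
  \<comment> \<open>The basis may fail to be orthogonal, but vectors with equal eigenvalues share
    the real factor \<open>r\<close>, and those with different eigenvalues are orthogonal.\<close>
  have "cinner b (R c) = cinner (R b) c" if "b \<in> B" "c \<in> B" for b c
  proof (cases "l b = l c")
    case True
    then show ?thesis
      using that by (simp add: R r_def cinner_scaleC_left cinner_scaleC_right)
  next
    case False
    then have "cinner b c = 0"
      using self_adjoint_eigenvectors_orthogonal[OF sa l l] that by blast
    then show ?thesis
      using that by (simp add: R cinner_scaleC_left cinner_scaleC_right)
  qed
  then have saR: "self_adjoint R"
    using self_adjoint_if_on_span[OF lin span] by blast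
  define S where "S = R \<circ> R"
  have S: "positive_operator S"
    unfolding S_def by (rule positive_operator_square[OF saR])
  then have linS: "clinear S"
    by (simp add: positive_operator_def)
  have "S \<circ> S = A"
  proof (rule clinear_eq_on_span[OF _ self_adjoint_clinear[OF sa] span])
    show "clinear (S \<circ> S)"
      using linS by (intro Vector_Spaces.linear_compose)
    fix b assume b: "b \<in> B"
    have "(S \<circ> S) b = scaleC (r b ^ 4) b"
      by (simp add: S_def R[OF b] clinear_scaleC[OF lin] power4_eq_xxxx mult.assoc)
    also have "r b ^ 4 = complex_of_real (((sqrt (sqrt (Re (l b))))\<^sup>2)\<^sup>2)"
      by (simp add: r_def)
    also have "\<dots> = complex_of_real (Re (l b))"
      using positive_operator_eigenvalue(2)[OF assms l[OF b] nz[OF b]] by simp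
    also have "\<dots> = l b"
      by (rule positive_operator_eigenvalue(1)[OF assms l[OF b] nz[OF b], symmetric])
    finally show "(S \<circ> S) b = A b"
      using l[OF b] by simp
  qed
  with S show ?thesis
    by blast
qed

text \<open>The defect w = (S - \<mu>) v satisfies S w = -\<mu> w. Positivity of \<open>S\<close>
  then leaves only \<mu> = 0 if w is nonzero, and in that case S (S v) = 0 already gives S v =
  0.\<close>

lemma eigenvector_of_square_root:
  assumes "positive_operator S" "S (S v) = scaleC (\<mu>\<^sup>2) v" "\<mu> = complex_of_real r" "0 \<le> r"
  shows "S v = scaleC \<mu> v"
proof (rule ccontr)
  assume *: "S v \<noteq> scaleC \<mu> v"
  note sa = positive_operator_self_adjoint[OF assms(1)]
  note lin = self_adjoint_clinear[OF sa]
  define w where "w = S v - scaleC \<mu> v"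
  have "S w = scaleC (- \<mu>) w"
    by (simp add: w_def clinear_diff[OF lin] clinear_scaleC[OF lin] assms(2)
        scaleC.scale_right_diff_distrib power2_eq_square)
  from positive_operator_eigenvalue(2)[OF assms(1) this] have "0 \<le> - r"
    using * assms(3) by (simp add: w_def)
  with assms have "\<mu> = 0"
    by simp
  then have "cinner (S v) (S v) = 0"
    using assms(2) by (simp flip: self_adjointD[OF sa])
  with * \<open>\<mu> = 0\<close> show False
    by simp
qed

text \<open>The eigenvectors of \<open>R\<close> span, and on each of them \<open>S\<close> is
  forced to have the same nonnegative eigenvalue.\<close>

lemma positive_square_root_unique:
  assumes "positive_operator S" "positive_operator R" "S \<circ> S = R \<circ> R"
  shows "S = R"
proof -
  have lin: "clinear S" "clinear R"
    using assms(1,2) by (auto simp: positive_operator_def)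
  show ?thesis
  proof (rule clinear_eq_on_span[OF lin
        span_eigenvectors_eq_UNIV[OF positive_operator_self_adjoint[OF assms(2)]]])
    fix v assume "v \<in> {v. \<exists>\<mu>. R v = scaleC \<mu> v}"
    then obtain \<mu> where \<mu>: "R v = scaleC \<mu> v"
      by blast
    show "S v = R v"
    proof (cases "v = 0")
      case False
      have "S (S v) = scaleC (\<mu>\<^sup>2) v"
        using fun_cong[OF assms(3), of v]
        by (simp add: \<mu> clinear_scaleC[OF lin(2)] power2_eq_square)
      then show ?thesis
        using eigenvector_of_square_root[OF assms(1) _ positive_operator_eigenvalue[OF assms(2) \<mu> False]]
          \<mu> by simp
    qed (simp add: clinear_zero lin)
  qed
qed

lemma sqrt_operator:
  assumes "positive_operator A"
  shows "positive_operator (sqrt_operator A)" "sqrt_operator A (sqrt_operator A x) = A x"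
proof -
  have "\<exists>!S. positive_operator S \<and> S \<circ> S = A"
    using positive_square_root_exists[OF assms] positive_square_root_unique by blast
  from theI'[OF this] have *: "positive_operator (sqrt_operator A) \<and> sqrt_operator A \<circ> sqrt_operator A = A"
    unfolding sqrt_operator_def .
  then show "positive_operator (sqrt_operator A)"
    by blast
  show "sqrt_operator A (sqrt_operator A x) = A x"
    using * by (metis comp_apply)
qed

subsection \<open>The three lines theorem for exponential sums\<close>

text \<open>The version with one bound for both lines. The a priori bound \<open>K\<close> controls
  \<open>f\<close> far up and down the strip, where the maximum principle for bounded domains gives
  nothing.\<close>

lemma three_lines_bounded:
  fixes f :: "complex \<Rightarrow> complex"
  assumes hol: "f holomorphic_on {z. 0 < Re z \<and> Re z < 1}"
    and cont: "continuous_on {z. 0 \<le> Re z \<and> Re z \<le> 1} f"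
    and bounded: "\<And>z. 0 \<le> Re z \<Longrightarrow> Re z \<le> 1 \<Longrightarrow> cmod (f z) \<le> K"
    and left: "\<And>z. Re z = 0 \<Longrightarrow> cmod (f z) \<le> B"
    and right: "\<And>z. Re z = 1 \<Longrightarrow> cmod (f z) \<le> B"
    and z: "0 \<le> Re z" "Re z \<le> 1"
  shows "cmod (f z) \<le> B"
proof (rule dense_ge)
  \<comment> \<open>Passing to \<open>C > B\<close> provides a positive bound even if
    \<open>B = 0\<close>; the decaying term at height \<open>T\<close> can then be pushed below
    it.\<close>
  fix C assume "B < C"
  then have left': "cmod (f w) \<le> C" if "Re w = 0" for w
    using left[OF that] by simp
  from \<open>B < C\<close> have right': "cmod (f w) \<le> C" if "Re w = 1" for w
    using right[OF that] by simp
  have "0 < C"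
    using order.strict_trans1[OF order_trans[OF norm_ge_zero left[of 0]] \<open>B < C\<close>] by simp
  have "0 \<le> K"
    using bounded[of 0] norm_ge_zero[of "f 0"] by (simp del: norm_ge_zero)
  \<comment> \<open>The Gaussian factor makes the boundary bound hold on the horizontal sides of a tall rectangle.\<close>
  have bound: "cmod (f z) * exp (e * ((Re z)\<^sup>2 - (Im z)\<^sup>2 - 1)) \<le> C" if "e > 0" for e
  proof -
    \<comment> \<open>The summand -1 offsets (Re w)^2 \<le> 1, so on the strip the factor has
      modulus at most exp(-e (Im w)^2).\<close>
    define g where "g w = f w * exp (complex_of_real e * (w\<^sup>2 - 1))" for w
    have g: "cmod (g w) = cmod (f w) * exp (e * ((Re w)\<^sup>2 - (Im w)\<^sup>2 - 1))" for w
      by (simp add: g_def norm_mult power2_eq_square)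
    have "((\<lambda>t. K * exp (- (e * t\<^sup>2))) \<longlongrightarrow> 0) at_top"
      using that by real_asymp
    then have "\<forall>\<^sub>F t in at_top. K * exp (- (e * t\<^sup>2)) < C"
      using \<open>0 < C\<close> by (rule order_tendstoD)
    then have "\<forall>\<^sub>F t in at_top. K * exp (- (e * t\<^sup>2)) < C \<and> t > \<bar>Im z\<bar>"
      by (intro eventually_conj eventually_gt_at_top)
    then obtain T where T: "K * exp (- (e * T\<^sup>2)) < C" "\<bar>Im z\<bar> < T"
      using eventually_happens'[OF trivial_limit_at_top_linorder] by blast
    define Q where "Q = cbox (Complex 0 (-T)) (Complex 1 T)"
    have "cmod (g z) \<le> C"
    proof (rule maximum_modulus_frontier[of g Q])
      have "interior Q \<subseteq> {z. 0 < Re z \<and> Re z < 1}"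
        by (auto simp: Q_def in_box_complex_iff)
      then show "g holomorphic_on interior Q"
        unfolding g_def by (intro holomorphic_intros holomorphic_on_subset[OF hol])
      have "Q \<subseteq> {z. 0 \<le> Re z \<and> Re z \<le> 1}"
        by (auto simp: Q_def in_cbox_complex_iff)
      then show "continuous_on (closure Q) g"
        unfolding g_def
        by (intro continuous_intros continuous_on_subset[OF cont]) (auto simp: Q_def)
      show "bounded Q" "z \<in> Q"
        using z T(2) by (auto simp: Q_def in_cbox_complex_iff)
      fix w assume "w \<in> frontier Q"
      then consider "Re w \<in> {0, 1}" | "Re w \<in> {0..1}" "Im w \<in> {-T, T}"
        by (force simp: Q_def frontier_cbox in_cbox_complex_iff in_box_complex_iff)
      then show "cmod (g w) \<le> C"
      proof cases
        case 1
        then have "cmod (f w) \<le> C" "(Re w)\<^sup>2 \<le> 1"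
          using left'[of w] right'[of w] by auto
        moreover from this have "e * ((Re w)\<^sup>2 - (Im w)\<^sup>2 - 1) \<le> 0"
          using \<open>e > 0\<close> zero_le_power2[of "Im w"]
          by (intro mult_nonneg_nonpos) linarith+
        ultimately have "cmod (g w) \<le> C * 1"
          unfolding g using \<open>0 < C\<close> by (intro mult_mono) auto
        then show ?thesis by simp
      next
        case 2
        then have "(Re w)\<^sup>2 \<le> 1" "(Im w)\<^sup>2 = T\<^sup>2"
          by (auto simp: power_le_one)
        then have "e * ((Re w)\<^sup>2 - (Im w)\<^sup>2 - 1) \<le> e * (- T\<^sup>2)"
          using \<open>e > 0\<close> by (intro mult_left_mono) auto
        then have "cmod (g w) \<le> K * exp (- (e * T\<^sup>2))"
          unfolding g using 2 bounded[of w] \<open>0 \<le> K\<close> by (intro mult_mono) auto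
        then show ?thesis
          using T(1) by simp
      qed
    qed
    then show ?thesis
      by (simp add: g)
  qed
  \<comment> \<open>Letting e tend to 0 removes the Gaussian factor.\<close>
  have "((\<lambda>e. cmod (f z) * exp (e * ((Re z)\<^sup>2 - (Im z)\<^sup>2 - 1))) \<longlongrightarrow>
      cmod (f z) * exp (0 * ((Re z)\<^sup>2 - (Im z)\<^sup>2 - 1))) (at_right 0)"
    by (intro tendsto_intros)
  moreover have "\<forall>\<^sub>F e in at_right 0. cmod (f z) * exp (e * ((Re z)\<^sup>2 - (Im z)\<^sup>2 - 1)) \<le> C"
    by (rule eventually_mono[OF eventually_at_right_less bound])
  ultimately show "cmod (f z) \<le> C"
    using tendsto_upperbound[OF _ _ trivial_limit_at_right_real] by fastforce
qed

text \<open>The sum is the derivative at 0 of Re F along the real axis. There Re F equals 1 at 0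
  and, by the three lines theorem, is at most 1 on [0, 1], so it cannot increase to the right of
  0.\<close>

lemma exp_sum_derivative_nonpos:
  fixes K :: "'k set" and t :: "'k \<Rightarrow> complex" and r :: "'k \<Rightarrow> real"
  defines "F \<equiv> \<lambda>z. \<Sum>k\<in>K. t k * exp (z * complex_of_real (r k))"
  assumes left: "\<And>z. Re z = 0 \<Longrightarrow> cmod (F z) \<le> 1"
    and right: "\<And>z. Re z = 1 \<Longrightarrow> cmod (F z) \<le> 1"
    and sum: "(\<Sum>k\<in>K. t k) = 1"
  shows "(\<Sum>k\<in>K. Re (t k) * r k) \<le> 0"
proof (rule ccontr)
  have F_le: "cmod (F z) \<le> 1" if "0 \<le> Re z" "Re z \<le> 1" for z
  proof (rule three_lines_bounded[where f = F and B = 1 and K = "\<Sum>k\<in>K. cmod (t k) * exp \<bar>r k\<bar>"])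
    show "F holomorphic_on {z. 0 < Re z \<and> Re z < 1}"
      unfolding F_def by (intro holomorphic_intros)
    show "continuous_on {z. 0 \<le> Re z \<and> Re z \<le> 1} F"
      unfolding F_def by (intro continuous_intros)
    fix z :: complex assume z: "0 \<le> Re z" "Re z \<le> 1"
    have "Re z * r k \<le> \<bar>r k\<bar>" for k
      using z by (metis abs_le_D1 abs_mult abs_of_nonneg mult_left_le_one_le abs_ge_zero)
    then show "cmod (F z) \<le> (\<Sum>k\<in>K. cmod (t k) * exp \<bar>r k\<bar>)"
      unfolding F_def by (intro sum_norm_le) (simp add: norm_mult mult_left_mono)
  qed (use that left right in auto)
  define h where "h x = (\<Sum>k\<in>K. Re (t k) * exp (x * r k))" for x :: real
  have h: "h x = Re (F (complex_of_real x))" for x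
    by (simp add: h_def F_def Re_exp Im_exp)
  have "(h has_real_derivative (\<Sum>k\<in>K. Re (t k) * r k)) (at 0)"
    unfolding h_def by (auto intro!: derivative_eq_intros sum.cong)
  moreover assume "\<not> (\<Sum>k\<in>K. Re (t k) * r k) \<le> 0"
  ultimately obtain d where d: "d > 0" "\<And>x. 0 < x \<Longrightarrow> x < d \<Longrightarrow> h 0 < h x"
    using has_real_derivative_pos_inc_right[of h "\<Sum>k\<in>K. Re (t k) * r k" 0 UNIV] by auto
  define x where "x = min (d / 2) 1"
  have "0 < x" "x < d" "x \<le> 1"
    using d(1) by (auto simp: x_def)
  then have "h 0 < h x" "h x \<le> 1"
    using d(2) F_le[of "complex_of_real x"] complex_Re_le_cmod[of "F (complex_of_real x)"]
    by (auto simp: h)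
  moreover have "h 0 = 1"
    using arg_cong[OF sum, of Re] by (simp add: h_def)
  ultimately show False
    by simp
qed

subsection \<open>Measurements and entropy\<close>

declare One_nat_def [simp del]

lemma measurementD:
  assumes "measurement m X"
  shows "i \<in> {1..m} \<Longrightarrow> positive_operator (X i)" "(\<Sum>i=1..m. X i x) = x"
  using assms by (auto simp: measurement_def)

section \<open>Outcome probabilities through square roots\<close>

lemma cinner_positive_operator:
  assumes "positive_operator A"
  shows "cinner x (A y) = cinner (sqrt_operator A x) (sqrt_operator A y)"
  using self_adjointD[OF positive_operator_self_adjoint[OF sqrt_operator(1)[OF assms]]]
  by (metis sqrt_operator(2)[OF assms])

lemma outcome_prob_eq_norm:
  assumes "positive_operator A"
  shows "outcome_prob A x = (norm (sqrt_operator A x))\<^sup>2"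
  by (simp add: outcome_prob_def cinner_positive_operator[OF assms] cinner_self flip: of_real_power)

lemma measurement_sum_outcome_prob:
  assumes "measurement m X"
  shows "(\<Sum>i=1..m. outcome_prob (X i) x) = (norm x)\<^sup>2"
proof -
  have "(\<Sum>i=1..m. outcome_prob (X i) x) = Re (cinner x (\<Sum>i=1..m. X i x))"
    by (simp add: outcome_prob_def cinner_sum_right)
  then show ?thesis
    by (simp add: measurementD(2)[OF assms] cinner_self flip: of_real_power)
qed

text \<open>Let y be the sum. Pairing it with itself and splitting each \<open>X i\<close> into its
  roots, Cauchy-Schwarz over i bounds |y|^2 by |y| |x|, because the squared norms of the root
  vectors of any z add up to |z|^2.\<close>

lemma norm_measurement_sum_le:
  assumes "measurement m X" "\<And>i. cmod (u i) \<le> 1"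
  shows "norm (\<Sum>i=1..m. scaleC (u i) (X i x)) \<le> norm x"
proof -
  define y where "y = (\<Sum>i=1..m. scaleC (u i) (X i x))"
  have L2: "L2_set (\<lambda>i. norm (sqrt_operator (X i) z)) {1..m} = norm z" for z
  proof -
    have "(\<Sum>i=1..m. (norm (sqrt_operator (X i) z))\<^sup>2) = (norm z)\<^sup>2"
      using measurement_sum_outcome_prob[OF assms(1), of z]
      by (simp add: outcome_prob_eq_norm measurementD(1)[OF assms(1)])
    then show ?thesis
      by (simp add: L2_set_def)
  qed
  have "(norm y)\<^sup>2 = cmod (cinner y y)"
    by (simp add: cinner_self norm_power)
  also have "\<dots> = cmod (\<Sum>i=1..m. u i * cinner y (X i x))"
    by (subst (2) y_def) (simp add: cinner_sum_right cinner_scaleC_right)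
  also have "\<dots> \<le> (\<Sum>i=1..m. norm (sqrt_operator (X i) y) * norm (sqrt_operator (X i) x))"
  proof (rule sum_norm_le)
    fix i assume "i \<in> {1..m}"
    then have "cmod (cinner y (X i x)) \<le> norm (sqrt_operator (X i) y) * norm (sqrt_operator (X i) x)"
      by (simp only: cinner_positive_operator[OF measurementD(1)[OF assms(1)]] cmod_cinner_le)
    moreover have "cmod (u i * cinner y (X i x)) \<le> 1 * cmod (cinner y (X i x))"
      unfolding norm_mult by (intro mult_right_mono assms(2)) simp
    ultimately show "cmod (u i * cinner y (X i x))
        \<le> norm (sqrt_operator (X i) y) * norm (sqrt_operator (X i) x)"
      by simp
  qed
  also have "\<dots> \<le> norm y * norm x"
    using L2_set_mult_ineq[of "\<lambda>i. norm (sqrt_operator (X i) y)"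
        "\<lambda>i. norm (sqrt_operator (X i) x)" "{1..m}"] by (simp add: L2)
  finally have "norm y * norm y \<le> norm y * norm x"
    by (simp add: power2_eq_square)
  then show ?thesis
    unfolding y_def[symmetric] by (cases "y = 0") auto
qed

text \<open>Probabilities are squared norms, whence the factor 2; division by \<open>ln 2\<close>
  converts nats to bits. Outcomes of probability 0 contribute 0 on both sides.\<close>

lemma measurement_entropy_eq_ln_norm:
  assumes "measurement m X"
  shows "measurement_entropy m X \<psi> =
    - 2 / ln 2 * (\<Sum>i=1..m. outcome_prob (X i) \<psi> * ln (norm (sqrt_operator (X i) \<psi>)))"
proof -
  have "outcome_prob (X i) \<psi> * log 2 (outcome_prob (X i) \<psi>) =
      2 / ln 2 * (outcome_prob (X i) \<psi> * ln (norm (sqrt_operator (X i) \<psi>)))" if "i \<in> {1..m}" for i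
    using outcome_prob_eq_norm[OF measurementD(1)[OF assms that], of \<psi>]
    by (cases "sqrt_operator (X i) \<psi> = 0") (simp_all add: log_def ln_realpow)
  then show ?thesis
    by (simp add: measurement_entropy_def sum_distrib_left sum_negf)
qed

text \<open>Any positive bound \<open>c\<close> is allowed, and the bound avoids division so as to
  cover pairs with a vanishing norm, which are absent from the maximum.\<close>

lemma measurement_entropy_sum_ge:
  fixes \<psi> :: "'a::fd_complex_hilbert"
  assumes X: "measurement m X" and Y: "measurement n Y"
    and "norm \<psi> = 1" "0 < c"
    and c: "\<And>i j. i \<in> {1..m} \<Longrightarrow> j \<in> {1..n} \<Longrightarrow> cmod (cinner \<psi> (X i (Y j \<psi>)))
       \<le> c * (norm (sqrt_operator (X i) \<psi>) * norm (sqrt_operator (Y j) \<psi>))"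
  shows "- 2 * log 2 c \<le> measurement_entropy m X \<psi> + measurement_entropy n Y \<psi>"
proof -
  define a where "a i = norm (sqrt_operator (X i) \<psi>)" for i
  define b where "b j = norm (sqrt_operator (Y j) \<psi>)" for j
  define K where "K = {1..m} \<times> {1..n}"
  define t where "t = (\<lambda>(i, j). cinner \<psi> (X i (Y j \<psi>)))"
  \<comment> \<open>\<open>exp (z * r)\<close> is the z-th power of a b / c, where a b is the root
    of p q; subtracting \<open>ln c\<close> normalizes the bound on Re z = 1 to 1. If
    \<open>a i\<close> or \<open>b j\<close> is 0, the value of \<open>ln\<close> is harmless, since
    then \<open>t (i, j) = 0\<close>.\<close>
  define r where "r = (\<lambda>(i, j). ln (a i) + ln (b j) - ln c)"
  have t: "t (i, j) = cinner (X i \<psi>) (Y j \<psi>)" if "i \<in> {1..m}" for i j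
    using self_adjointD[OF positive_operator_self_adjoint[OF measurementD(1)[OF X that]]]
    by (simp add: t_def)
  \<comment> \<open>\<open>t\<close> behaves like a complex joint distribution: completeness of
    either measurement yields the outcome probabilities of the other as marginals.\<close>
  have t_left: "(\<Sum>i=1..m. t (i, j)) = cinner \<psi> (Y j \<psi>)" for j
    by (simp add: t measurementD(2)[OF X] flip: cinner_sum_left)
  have t_right: "(\<Sum>j=1..n. t (i, j)) = cinner \<psi> (X i \<psi>)" if "i \<in> {1..m}" for i
    using self_adjointD[OF positive_operator_self_adjoint[OF measurementD(1)[OF X that]]]
    by (simp add: t[OF that] measurementD(2)[OF Y] flip: cinner_sum_right)
  have sum_t: "(\<Sum>k\<in>K. t k) = 1"
  proof -
    have "(\<Sum>k\<in>K. t k) = (\<Sum>i=1..m. \<Sum>j=1..n. t (i, j))"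
      by (simp add: K_def sum.cartesian_product)
    also have "\<dots> = (\<Sum>i=1..m. cinner \<psi> (X i \<psi>))"
      by (simp add: t_right)
    also have "\<dots> = 1"
      by (simp add: measurementD(2)[OF X] cinner_self \<open>norm \<psi> = 1\<close> flip: cinner_sum_right)
    finally show ?thesis .
  qed
  have "(\<Sum>k\<in>K. Re (t k) * r k) \<le> 0"
  proof (rule exp_sum_derivative_nonpos[OF _ _ sum_t])
    fix z :: complex assume z: "Re z = 0"
    \<comment> \<open>For imaginary z these powers are unimodular, so the double sum is, up to a
      phase, the inner product of two vectors of norm at most 1. Conjugates enter because
      \<open>cinner\<close> is conjugate-linear on the left.\<close>
    define u where "u i = exp (z * complex_of_real (ln (a i)))" for i
    define v where "v j = exp (z * complex_of_real (ln (b j)))" for j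
    have uv: "cmod (u i) = 1" "cmod (v i) = 1" for i
      by (simp_all add: u_def v_def z)
    have "(\<Sum>k\<in>K. t k * exp (z * complex_of_real (r k))) =
        (\<Sum>i=1..m. \<Sum>j=1..n. t (i, j) * (u i * v j * exp (- z * complex_of_real (ln c))))"
      by (simp add: K_def sum.cartesian_product r_def u_def v_def case_prod_unfold
          algebra_simps flip: exp_add)
    also have "\<dots> = exp (- z * complex_of_real (ln c)) *
        (\<Sum>i=1..m. \<Sum>j=1..n. u i * (v j * cinner (X i \<psi>) (Y j \<psi>)))"
      by (simp add: t sum_distrib_left mult_ac)
    also have "(\<Sum>i=1..m. \<Sum>j=1..n. u i * (v j * cinner (X i \<psi>) (Y j \<psi>))) =
        cinner (\<Sum>i=1..m. scaleC (cnj (u i)) (X i \<psi>)) (\<Sum>j=1..n. scaleC (v j) (Y j \<psi>))"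
      by (subst sum.swap) (simp add: cinner_sum_left cinner_sum_right cinner_scaleC_left
          cinner_scaleC_right sum_distrib_left mult_ac)
    finally have "cmod (\<Sum>k\<in>K. t k * exp (z * complex_of_real (r k))) = cmod (cinner
        (\<Sum>i=1..m. scaleC (cnj (u i)) (X i \<psi>)) (\<Sum>j=1..n. scaleC (v j) (Y j \<psi>)))"
      by (simp add: norm_mult z)
    also have "\<dots> \<le> norm (\<Sum>i=1..m. scaleC (cnj (u i)) (X i \<psi>)) *
        norm (\<Sum>j=1..n. scaleC (v j) (Y j \<psi>))"
      by (rule cmod_cinner_le)
    also have "\<dots> \<le> norm \<psi> * norm \<psi>"
      by (intro mult_mono norm_measurement_sum_le[OF X] norm_measurement_sum_le[OF Y])
        (simp_all add: uv)
    finally show "cmod (\<Sum>k\<in>K. t k * exp (z * complex_of_real (r k))) \<le> 1"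
      by (simp add: \<open>norm \<psi> = 1\<close>)
  next
    fix z :: complex assume z: "Re z = 1"
    \<comment> \<open>One factor a b comes from the hypothesis on \<open>c\<close>, the other from
      the exponential, and \<open>c\<close> cancels; the resulting products of probabilities sum to
      1.\<close>
    have bound: "cmod (t (i, j)) * exp (r (i, j)) \<le> (a i)\<^sup>2 * (b j)\<^sup>2"
      if ij: "i \<in> {1..m}" "j \<in> {1..n}" for i j
    proof (cases "a i = 0 \<or> b j = 0")
      case True
      then show ?thesis
        using c[OF ij] by (auto simp: t_def a_def b_def)
    next
      case False
      then have "0 < a i" "0 < b j"
        by (auto simp: a_def b_def)
      then have "exp (r (i, j)) = a i * b j / c"
        using \<open>0 < c\<close> by (simp add: r_def exp_add exp_diff)
      moreover have "cmod (t (i, j)) \<le> c * (a i * b j)"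
        using c[OF ij] by (simp add: t_def a_def b_def)
      ultimately have "cmod (t (i, j)) * exp (r (i, j)) \<le> c * (a i * b j) * (a i * b j / c)"
        using \<open>0 < a i\<close> \<open>0 < b j\<close> \<open>0 < c\<close> by (simp only:) (intro mult_right_mono, auto)
      then show ?thesis
        using \<open>0 < c\<close> by (simp add: power2_eq_square mult_ac)
    qed
    have "cmod (\<Sum>k\<in>K. t k * exp (z * complex_of_real (r k))) \<le>
        (\<Sum>(i, j)\<in>K. (a i)\<^sup>2 * (b j)\<^sup>2)"
      by (rule sum_norm_le) (use bound in \<open>auto simp: K_def norm_mult z\<close>)
    also have "\<dots> = (\<Sum>i=1..m. (a i)\<^sup>2) * (\<Sum>j=1..n. (b j)\<^sup>2)"
      by (simp add: K_def sum_product sum.cartesian_product)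
    also have "\<dots> = 1"
      using measurement_sum_outcome_prob[OF X, of \<psi>] measurement_sum_outcome_prob[OF Y, of \<psi>]
      by (simp add: outcome_prob_eq_norm measurementD(1)[OF X] measurementD(1)[OF Y] a_def b_def
          \<open>norm \<psi> = 1\<close>)
    finally show "cmod (\<Sum>k\<in>K. t k * exp (z * complex_of_real (r k))) \<le> 1" .
  qed
  \<comment> \<open>The logarithm splits into a part depending on i, a part depending on j and a
    constant, so only the marginals and the total of \<open>t\<close> matter.\<close>
  moreover have "(\<Sum>k\<in>K. Re (t k) * r k) =
    (\<Sum>i=1..m. outcome_prob (X i) \<psi> * ln (a i)) + (\<Sum>j=1..n. outcome_prob (Y j) \<psi> * ln (b j)) - ln c"
  proof -
    have "(\<Sum>k\<in>K. Re (t k) * r k) = (\<Sum>i=1..m. \<Sum>j=1..n. Re (t (i, j)) * ln (a i)) +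
        (\<Sum>i=1..m. \<Sum>j=1..n. Re (t (i, j)) * ln (b j)) - (\<Sum>k\<in>K. Re (t k) * ln c)"
      by (simp add: K_def r_def sum.cartesian_product case_prod_unfold algebra_simps
          sum.distrib sum_subtractf)
    also have "(\<Sum>i=1..m. \<Sum>j=1..n. Re (t (i, j)) * ln (a i)) =
        (\<Sum>i=1..m. outcome_prob (X i) \<psi> * ln (a i))"
      by (simp add: outcome_prob_def t_right flip: sum_distrib_right Re_sum)
    also have "(\<Sum>i=1..m. \<Sum>j=1..n. Re (t (i, j)) * ln (b j)) =
        (\<Sum>j=1..n. outcome_prob (Y j) \<psi> * ln (b j))"
      by (subst sum.swap) (simp add: outcome_prob_def t_left flip: sum_distrib_right Re_sum)
    also have "(\<Sum>k\<in>K. Re (t k) * ln c) = ln c"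
      by (simp add: sum_t flip: sum_distrib_right Re_sum)
    finally show ?thesis .
  qed
  ultimately have "(\<Sum>i=1..m. outcome_prob (X i) \<psi> * ln (a i)) +
      (\<Sum>j=1..n. outcome_prob (Y j) \<psi> * ln (b j)) \<le> ln c"
    by simp
  then have "2 / ln 2 * ((\<Sum>i=1..m. outcome_prob (X i) \<psi> * ln (a i)) +
      (\<Sum>j=1..n. outcome_prob (Y j) \<psi> * ln (b j))) \<le> 2 / ln 2 * ln c"
    by (intro mult_left_mono) auto
  then show ?thesis
    unfolding measurement_entropy_eq_ln_norm[OF X] measurement_entropy_eq_ln_norm[OF Y]
      a_def[symmetric] b_def[symmetric]
    by (simp add: log_def algebra_simps)
qed

theorem theorem2p5:
  fixes \<psi> :: "'a::fd_complex_hilbert"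
    and X Y :: "nat \<Rightarrow> 'a \<Rightarrow> 'a"
    and m n :: nat
  assumes "measurement m X"
    and "measurement n Y"
    and "norm \<psi> = 1"
  shows "measurement_entropy m X \<psi> + measurement_entropy n Y \<psi>
    \<ge> - 2 * log 2 (Max {cmod (cinner \<psi> (X i (Y j \<psi>)))
                           / (norm (sqrt_operator (X i) \<psi>) * norm (sqrt_operator (Y j) \<psi>)) | i j.
                         i \<in> {1..m} \<and> j \<in> {1..n} \<and>
                         sqrt_operator (X i) \<psi> \<noteq> 0 \<and> sqrt_operator (Y j) \<psi> \<noteq> 0})"
proof -
  note X = assms(1) and Y = assms(2)
  define q where "q i j = cmod (cinner \<psi> (X i (Y j \<psi>)))
      / (norm (sqrt_operator (X i) \<psi>) * norm (sqrt_operator (Y j) \<psi>))" for i j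
  define M where "M = {q i j | i j. i \<in> {1..m} \<and> j \<in> {1..n} \<and>
      sqrt_operator (X i) \<psi> \<noteq> 0 \<and> sqrt_operator (Y j) \<psi> \<noteq> 0}"
  have "M \<subseteq> (\<lambda>(i, j). q i j) ` ({1..m} \<times> {1..n})"
    by (auto simp: M_def)
  then have "finite M"
    by (rule finite_subset) simp
  have q: "q i j \<le> Max M" if "i \<in> {1..m}" "j \<in> {1..n}"
    "sqrt_operator (X i) \<psi> \<noteq> 0" "sqrt_operator (Y j) \<psi> \<noteq> 0" for i j
    using that by (intro Max_ge[OF \<open>finite M\<close>]) (auto simp: M_def)
  \<comment> \<open>Pairs excluded from the maximum have a vanishing numerator, so they satisfy the
    required bound trivially.\<close>
  have zero: "sqrt_operator (X i) \<psi> \<noteq> 0" "sqrt_operator (Y j) \<psi> \<noteq> 0"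
    if ij: "i \<in> {1..m}" "j \<in> {1..n}" and nz: "cinner \<psi> (X i (Y j \<psi>)) \<noteq> 0" for i j
  proof -
    note pos = measurementD(1)[OF X ij(1)] measurementD(1)[OF Y ij(2)]
    show "sqrt_operator (X i) \<psi> \<noteq> 0"
      using nz by (auto simp: cinner_positive_operator[OF pos(1)])
    have "clinear (X i)" "clinear (sqrt_operator (Y j))"
      using pos sqrt_operator(1)[OF pos(2)] by (auto simp: positive_operator_def)
    then show "sqrt_operator (Y j) \<psi> \<noteq> 0"
      using nz sqrt_operator(2)[OF pos(2), of \<psi>] by (auto simp: clinear_zero)
  qed
  \<comment> \<open>The numbers inside the moduli add up to the squared norm of
    \<open>\<psi>\<close>, which is 1, so one of them is nonzero; its quotient is a positive member
    of \<open>M\<close>.\<close>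
  have "0 < Max M"
  proof -
    have "(\<Sum>i=1..m. \<Sum>j=1..n. cinner \<psi> (X i (Y j \<psi>))) =
      (\<Sum>j=1..n. cinner \<psi> (\<Sum>i=1..m. X i (Y j \<psi>)))"
      by (subst sum.swap) (simp add: cinner_sum_right)
    also have "\<dots> = 1"
      by (simp add: measurementD(2)[OF X] measurementD(2)[OF Y] cinner_self assms(3)
          flip: cinner_sum_right)
    finally obtain i j where ij: "i \<in> {1..m}" "j \<in> {1..n}" "cinner \<psi> (X i (Y j \<psi>)) \<noteq> 0"
      by (metis (no_types, lifting) sum.neutral zero_neq_one)
    then have "0 < q i j"
      using zero[OF ij] by (simp add: q_def)
    also have "\<dots> \<le> Max M"
      using q ij zero by blast
    finally show ?thesis .
  qed
  have "- 2 * log 2 (Max M) \<le> measurement_entropy m X \<psi> + measurement_entropy n Y \<psi>"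
  proof (rule measurement_entropy_sum_ge[OF X Y assms(3) \<open>0 < Max M\<close>])
    fix i j assume ij: "i \<in> {1..m}" "j \<in> {1..n}"
    show "cmod (cinner \<psi> (X i (Y j \<psi>)))
       \<le> Max M * (norm (sqrt_operator (X i) \<psi>) * norm (sqrt_operator (Y j) \<psi>))"
    proof (cases "cinner \<psi> (X i (Y j \<psi>)) = 0")
      case True
      then show ?thesis
        using \<open>0 < Max M\<close> by simp
    next
      case False
      then show ?thesis
        using q[OF ij zero[OF ij False]] zero[OF ij False] by (simp add: q_def pos_divide_le_eq)
    qed
  qed
  then show ?thesis
    by (simp only: M_def q_def)
qed

end
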